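(* Let $n\ge1$, let $(A_t)_{t\ge0}$ be row-stochastic matrices of size $n$, let $(\mathcal{E}_t)_{t\ge0}$ be real diagonal matrices of size $n$ with diagonal entries $\mathcal{E}_t(i)$, let $\bar\sigma=\sigma\mathbf{1}$ for some $\sigma\in\mathbb{R}$, let $X_0\in\mathbb{R}^n$, and consider the dynamics $$X_{t+1}=A_tX_t+\mathcal{E}_t(\bar\sigma-X_t),\qquad t\ge0.$$ Suppose that the learning rates satisfy the following conditions for all $i\in\{1,\dots,n\}$: (A1) there exists $T_1\in\mathbb{N}$ such that $0\le\mathcal{E}_t(i)\le A_t(i,i)$ for all $t\ge T_1$; (A2) $\lim_{t\to\infty}\mathcal{E}_t(i)=0$; (A3) $\sum_{t=0}^{\infty}\min_{i=1,\dots,n}\mathcal{E}_t(i)=\infty$. Then all agents reach consensus: $\lim_{t\to\infty}X_t=\bar\sigma$.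
   Context: A nonnegative real square matrix is row stochastic if each row-sum equals $1$. $\mathbf{1}$ is the all-ones vector in $\mathbb{R}^n$. *)

theory Defs
  imports "HOL-Analysis.Analysis"
begin

definition row_stochastic :: "real ^ 'n ^ 'n \<Rightarrow> bool" where
  "row_stochastic A \<longleftrightarrow> (\<forall>i j. 0 \<le> A $ i $ j) \<and> (\<forall>i. (\<Sum>j\<in>UNIV. A $ i $ j) = 1)"

definition diagonal_matrix :: "real ^ 'n ^ 'n \<Rightarrow> bool" where
  "diagonal_matrix D \<longleftrightarrow> (\<forall>i j. i \<noteq> j \<longrightarrow> D $ i $ j = 0)"

end

theory Submission
  imports Defs
begin

text \<open>
  The error \<open>Y t = X t - \<sigma>bar\<close> satisfies \<open>Y (t + 1) = (A t - E t) Y t\<close>, because row-stochastic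
  matrices fix constant vectors. Once \<open>E t i \<le> A t i i\<close>, the matrix \<open>A t - E t\<close> is entrywise
  nonnegative with row sums \<open>1 - E t i \<le> exp (- m t)\<close>, where \<open>m t\<close> is the minimal learning rate.
  The sup norm of the error is therefore multiplied by at most \<open>exp (- m t)\<close> at each step, and
  divergence of the sum of the \<open>m t\<close> sends it to zero.
\<close>

lemma row_stochastic_mult_scaleR_one:
  assumes "row_stochastic A"
  shows "A *v (c *\<^sub>R 1) = c *\<^sub>R 1"
  using assms by (simp add: vec_eq_iff matrix_vector_mult_def row_stochastic_def
      flip: sum_distrib_right)

text \<open>Row \<open>i\<close> of \<open>A - D\<close> is nonnegative: off the diagonal it agrees
  with \<open>A\<close>, on the diagonal \<open>le\<close> applies. Its sum is
  \<open>1 - D $ i $ i\<close>, so the triangle inequality gives the bound.\<close>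

lemma row_stochastic_minus_diagonal_bound:
  fixes A D :: "real ^ 'n ^ 'n"
  assumes A: "row_stochastic A" and D: "diagonal_matrix D"
    and le: "D $ i $ i \<le> A $ i $ i"
    and bound: "\<And>j. \<bar>v $ j\<bar> \<le> B"
  shows "\<bar>(A *v v - D *v v) $ i\<bar> \<le> (1 - D $ i $ i) * B"
proof -
  let ?w = "\<lambda>j. A $ i $ j - D $ i $ j"
  have nonneg: "0 \<le> ?w j" for j
    using A D le by (cases "i = j") (auto simp: row_stochastic_def diagonal_matrix_def)
  have "(\<Sum>j\<in>UNIV. D $ i $ j) = (\<Sum>j\<in>UNIV. if j = i then D $ i $ i else 0)"
    using D by (intro sum.cong) (auto simp: diagonal_matrix_def)
  then have row_sum: "(\<Sum>j\<in>UNIV. ?w j) = 1 - D $ i $ i"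
    using A by (simp add: row_stochastic_def sum_subtractf)
  have "\<bar>(A *v v - D *v v) $ i\<bar> = \<bar>\<Sum>j\<in>UNIV. ?w j * v $ j\<bar>"
    by (simp add: matrix_vector_mult_def sum_subtractf left_diff_distrib)
  also have "\<dots> \<le> (\<Sum>j\<in>UNIV. \<bar>?w j * v $ j\<bar>)"
    by (rule sum_abs)
  also have "\<dots> \<le> (\<Sum>j\<in>UNIV. ?w j * B)"
    using nonneg bound by (intro sum_mono) (simp add: abs_mult mult_left_mono)
  also have "\<dots> = (1 - D $ i $ i) * B"
    by (simp add: row_sum flip: sum_distrib_right)
  finally show ?thesis .
qed

theorem theorem3p1:
  fixes A :: "nat \<Rightarrow> real ^ 'n ^ 'n"
    and E :: "nat \<Rightarrow> real ^ 'n ^ 'n"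
    and \<sigma> :: real
    and \<sigma>bar :: "real ^ 'n"
    and X :: "nat \<Rightarrow> real ^ 'n"
  assumes stoch: "\<And>t. row_stochastic (A t)"
    and diag: "\<And>t. diagonal_matrix (E t)"
    and target: "\<sigma>bar = \<sigma> *\<^sub>R 1"
    and dyn: "\<And>t. X (Suc t) = A t *v X t + E t *v (\<sigma>bar - X t)"
    and A1: "\<And>i. \<exists>T1. \<forall>t\<ge>T1. 0 \<le> E t $ i $ i \<and> E t $ i $ i \<le> A t $ i $ i"
    and A2: "\<And>i. (\<lambda>t. E t $ i $ i) \<longlonglongrightarrow> 0"
    and A3: "filterlim (\<lambda>T. \<Sum>t<T. Min (range (\<lambda>i. E t $ i $ i))) at_top sequentially"
  shows "X \<longlonglongrightarrow> \<sigma>bar"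
proof -
  define Y where "Y t = X t - \<sigma>bar" for t
  define m where "m t = Min (range (\<lambda>i. E t $ i $ i))" for t
  define S where "S T = (\<Sum>t<T. m t)" for T
  have Y_Suc: "Y (Suc t) = A t *v Y t - E t *v Y t" for t
    using row_stochastic_mult_scaleR_one[OF stoch, of t \<sigma>]
    by (simp add: Y_def dyn target matrix_vector_mult_diff_distrib)
  \<comment> \<open>The threshold in \<open>A1\<close> depends on \<open>i\<close>; finiteness of
    the index type makes it uniform.\<close>
  have "\<forall>\<^sub>F t in sequentially. \<forall>i. E t $ i $ i \<le> A t $ i $ i"
  proof (intro eventually_all_finite)
    fix i
    show "\<forall>\<^sub>F t in sequentially. E t $ i $ i \<le> A t $ i $ i"
      using A1[of i] unfolding eventually_sequentially by blast
  qed
  then obtain T where T: "\<And>t i. t \<ge> T \<Longrightarrow> E t $ i $ i \<le> A t $ i $ i"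
    unfolding eventually_sequentially by blast
  \<comment> \<open>The factor is the product of \<open>exp (- m s)\<close> over
    \<open>T \<le> s < t\<close>. The induction keeps \<open>i\<close> arbitrary because one step
    for row \<open>i\<close> uses the bound on every component of \<open>Y t\<close>.\<close>
  have bound: "\<bar>Y t $ i\<bar> \<le> exp (S T - S t) * norm (Y T)" if "t \<ge> T" for t i
    using that
  proof (induction t arbitrary: i rule: dec_induct)
    case base
    show ?case by (simp add: component_le_norm_cart)
  next
    case (step t)
    let ?B = "exp (S T - S t) * norm (Y T)"
    have "m t \<le> E t $ i $ i"
      unfolding m_def by (intro Min_le) auto
    \<comment> \<open>\<open>1 + x \<le> exp x\<close> at \<open>x = - m t\<close> turns the product
      of contraction factors into the exponential of a sum, to which \<open>A3\<close>
      applies.\<close>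
    then have "1 - E t $ i $ i \<le> exp (- m t)"
      using exp_ge_add_one_self[of "- m t"] by linarith
    then have "(1 - E t $ i $ i) * ?B \<le> exp (- m t) * ?B"
      by (intro mult_right_mono) simp_all
    also have "\<dots> = exp (S T - S (Suc t)) * norm (Y T)"
      by (simp add: S_def algebra_simps flip: exp_add)
    finally show ?case
      using row_stochastic_minus_diagonal_bound[OF stoch diag T[OF step.hyps(1)] step.IH, of i]
      unfolding Y_Suc by linarith
  qed
  have "filterlim S at_top sequentially"
    using A3 unfolding S_def m_def .
  then have "filterlim (\<lambda>t. - S T + S t) at_top sequentially"
    by (rule filterlim_tendsto_add_at_top[OF tendsto_const])
  then have "filterlim (\<lambda>t. S T - S t) at_bot sequentially"
    by (simp add: filterlim_uminus_at_top)
  then have "(\<lambda>t. exp (S T - S t) * norm (Y T)) \<longlonglongrightarrow> 0"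
    by (intro tendsto_mult_left_zero filterlim_compose[OF exp_at_bot])
  \<comment> \<open>Squeeze: \<open>bound\<close> holds from \<open>T\<close> on, which suffices for
    the limit.\<close>
  then have "(\<lambda>t. Y t $ i) \<longlonglongrightarrow> 0" for i
    by (rule Lim_null_comparison[rotated])
      (auto simp: eventually_sequentially intro!: exI[of _ T] bound)
  then have "Y \<longlonglongrightarrow> 0"
    by (intro vec_tendstoI) simp
  then show ?thesis
    unfolding Y_def by (simp add: LIM_zero_cancel)
qed

end
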